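(* Let $\{\lambda_{\ell,k}\}_{1\le k\le N_x}$ be the eigenvalues of $\Phi_\ell$, $\ell=0,1$ (ordered according to common eigenvectors), and let $r\ge0$. Then the worst-case convergence factor $c_f$ of the fine-grid residual of two-level MGRIT with $r$FCF-relaxation is bounded by $$c_f\le\max_{1\le k\le N_x}|\lambda_{0,k}^{m_0}-\lambda_{1,k}|\,|\lambda_{0,k}|^{rm_0}\,\frac{1-|\lambda_{1,k}|^{N_1-1-r}}{1-|\lambda_{1,k}|}.$$
   Context: Fix $N_x\ge1$, a coarsening factor $m_0\in\mathbb{N}$, and $N_0$ such that $N_1=(N_0-1)/m_0+1$ is an integer. $\Phi_0,\Phi_1$ are $N_x\times N_x$ time-stepping matrices that are diagonalizable by the same set of eigenvectors, $\Phi_\ell=U\,\mathrm{diag}(\lambda_{\ell,1},\dots,\lambda_{\ell,N_x})\,U^{-1}$, and strongly stable, $\|\Phi_\ell\|<1$, so that $|\lambda_{\ell,k}|<1$ for all $\ell,k$. Norms are those of the diagonalized operators, i.e. $\|\cdot\|_2$ is understood as the $(\widetilde U\widetilde U^* )^{-1}$-norm, with $\widetilde U$ block diagonal with blocks $U$; it is the ordinary $\ell^2$-norm if $U$ is unitary. Vectors on level $\ell\in\{0,1\}$ consist of $N_\ell$ blocks of size $N_x$, indexed $0,\dots,N_\ell-1$. - $A_\ell$ ($N_\ell\times N_\ell$ blocks) is block lower bidiagonal with $I$ on the block diagonal and $-\Phi_\ell$ on the first block subdiagonal. - $R_0$ ($N_1\times N_0$ blocks): block row $0$ has $I$ in block column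 $0$; block row $j\ge1$ has $\Phi_0^{m_0-i}$ in block column $(j-1)m_0+i$, $i=1,\dots,m_0$; zeros elsewhere. - $P_0$ ($N_0\times N_1$ blocks): block column $j$ has $\Phi_0^i$ in block row $jm_0+i$ for $0\le i\le m_0-1$, $jm_0+i\le N_0-1$; zeros elsewhere. - $R_{I_0}$ ($N_1\times N_0$ blocks): block row $j$ has $I$ in block column $jm_0$, zeros elsewhere. Two-level MGRIT with $r$FCF-relaxation (F-relaxation followed by $r$ CF-relaxation steps) has error propagator $$\mathcal{E}=(I-P_0A_1^{-1}R_0A_0)P_0(I-R_0A_0P_0)^rR_{I_0}.$$ The errors satisfy $\mathbf e_{i+1}=\mathcal{E}\mathbf e_i$, $i\in\mathbb{N}_0$, and $\mathbf r_i=A_0\mathbf e_i$ is the fine-grid residual (up to sign) at iteration $i$. The worst-case convergence factor is $c_f=\max_i\|\mathbf r_{i+1}\|_2/\|\mathbf r_i\|_2$.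
   Formalization: For an arbitrary initial error the bound fails at i=0, so the max is over i≥1 in general, and over all i≥0 only if the initial residual vanishes at F-points (indices not multiples of m_0); for r>N_1-1 the exponent N_1-1-r is read as 0. *)

theory Defs
  imports
    "HOL-Library.Extended_Real"
    "Jordan_Normal_Form.Gauss_Jordan_Elimination"
    "Jordan_Normal_Form.Schur_Decomposition"
begin

(* Only applied to invertible matrices: U, block unit lower triangular ones, and V times its adjoint. *)
abbreviation minv :: "complex mat \<Rightarrow> complex mat" where
  "minv A \<equiv> the (mat_inverse A)"

(* M x N blocks of size n x n; block b occupies the scalar indices b * n, ..., b * n + n - 1. *)
definition block_mat :: "nat \<Rightarrow> nat \<Rightarrow> nat \<Rightarrow> (nat \<Rightarrow> nat \<Rightarrow> complex mat) \<Rightarrow> complex mat" where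
  "block_mat n M N B =
     mat (M * n) (N * n) (\<lambda>(i, j). B (i div n) (j div n) $$ (i mod n, j mod n))"

definition time_op :: "nat \<Rightarrow> nat \<Rightarrow> complex mat \<Rightarrow> complex mat" where
  "time_op n N \<Phi> = block_mat n N N
     (\<lambda>i j. if i = j then 1\<^sub>m n else if i = j + 1 then - \<Phi> else 0\<^sub>m n n)"

definition coarse_points :: "nat \<Rightarrow> nat \<Rightarrow> nat" where
  "coarse_points m N\<^sub>0 = (N\<^sub>0 - 1) div m + 1"

(* In block row j >= 1, column c = (j - 1) m + i with 1 <= i <= m. *)
definition ideal_restr :: "nat \<Rightarrow> nat \<Rightarrow> nat \<Rightarrow> complex mat \<Rightarrow> complex mat" where
  "ideal_restr n m N\<^sub>0 \<Phi> = block_mat n (coarse_points m N\<^sub>0) N\<^sub>0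
     (\<lambda>j c. if j = 0 then (if c = 0 then 1\<^sub>m n else 0\<^sub>m n n)
            else if c \<in> {(j - 1) * m + 1..(j - 1) * m + m} then \<Phi> ^\<^sub>m (m - (c - (j - 1) * m))
            else 0\<^sub>m n n)"

definition ideal_interp :: "nat \<Rightarrow> nat \<Rightarrow> nat \<Rightarrow> complex mat \<Rightarrow> complex mat" where
  "ideal_interp n m N\<^sub>0 \<Phi> = block_mat n N\<^sub>0 (coarse_points m N\<^sub>0)
     (\<lambda>b j. if b \<in> {j * m..<j * m + m} then \<Phi> ^\<^sub>m (b - j * m) else 0\<^sub>m n n)"

definition inj_restr :: "nat \<Rightarrow> nat \<Rightarrow> nat \<Rightarrow> complex mat" where
  "inj_restr n m N\<^sub>0 = block_mat n (coarse_points m N\<^sub>0) N\<^sub>0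
     (\<lambda>j c. if c = j * m then 1\<^sub>m n else 0\<^sub>m n n)"

definition mgrit_err_prop ::
    "nat \<Rightarrow> nat \<Rightarrow> nat \<Rightarrow> complex mat \<Rightarrow> complex mat \<Rightarrow> nat \<Rightarrow> complex mat" where
  "mgrit_err_prop n m N\<^sub>0 \<Phi>\<^sub>0 \<Phi>\<^sub>1 r =
     (let N\<^sub>1 = coarse_points m N\<^sub>0;
          A\<^sub>0 = time_op n N\<^sub>0 \<Phi>\<^sub>0;
          A\<^sub>1 = time_op n N\<^sub>1 \<Phi>\<^sub>1;
          R = ideal_restr n m N\<^sub>0 \<Phi>\<^sub>0;
          P = ideal_interp n m N\<^sub>0 \<Phi>\<^sub>0
      in (1\<^sub>m (N\<^sub>0 * n) - P * minv A\<^sub>1 * R * A\<^sub>0) * P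
           * (1\<^sub>m (N\<^sub>1 * n) - R * A\<^sub>0 * P) ^\<^sub>m r * inj_restr n m N\<^sub>0)"

definition block_diag :: "nat \<Rightarrow> nat \<Rightarrow> complex mat \<Rightarrow> complex mat" where
  "block_diag n N U = block_mat n N N (\<lambda>i j. if i = j then U else 0\<^sub>m n n)"

(* For invertible V and its adjoint V', the norm induced by the positive definite inverse of V V'.
   With V = block_diag n N U this is the norm on N blocks; it is the l2-norm if U is unitary. *)
definition eig_norm :: "complex mat \<Rightarrow> complex vec \<Rightarrow> real" where
  "eig_norm V x = sqrt (Re ((minv (V * mat_adjoint V) *\<^sub>v x) \<bullet>c x))"

(* The supremum is taken in ereal, so it needs no boundedness side condition. *)
definition eig_op_norm :: "nat \<Rightarrow> complex mat \<Rightarrow> complex mat \<Rightarrow> ereal" where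
  "eig_op_norm n V M =
     (SUP x \<in> {x \<in> carrier_vec n. x \<noteq> 0\<^sub>v n}. ereal (eig_norm V (M *\<^sub>v x) / eig_norm V x))"

(* A supremum over all of I; for MGRIT it is a maximum, as the error propagator is nilpotent. If the residual at step i is
   zero, so is the next one, and 0 / 0 = 0 makes that step contribute the harmless value 0. *)
definition worst_case_factor :: "complex mat \<Rightarrow> (nat \<Rightarrow> complex vec) \<Rightarrow> nat set \<Rightarrow> ereal" where
  "worst_case_factor V res I = (SUP i \<in> I. ereal (eig_norm V (res (Suc i)) / eig_norm V (res i)))"

(* F-points are the fine time points whose index is not a multiple of m. This holds after
   F-relaxation; every MGRIT iteration ends in such a state, an arbitrary initial guess need
   not satisfy it. *)
definition vanishes_at_F_points :: "nat \<Rightarrow> nat \<Rightarrow> nat \<Rightarrow> complex vec \<Rightarrow> bool" where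
  "vanishes_at_F_points n m N\<^sub>0 x \<longleftrightarrow> (\<forall>b<N\<^sub>0. \<not> m dvd b \<longrightarrow> (\<forall>s<n. x $ (b * n + s) = 0))"

end

theory Submission
  imports Defs "HOL-Analysis.L2_Norm"
begin

text \<open>In the common eigenbasis all block operators decouple into scalar ones, one per eigenvalue pair
  \<open>(\<lambda>, \<mu>) = (\<mu>\<^sub>0 k, \<mu>\<^sub>1 k)\<close>, and the weighted norm becomes the sum of squares over the modes. After one
  iteration the residual lives on the C-points. If \<open>s\<close> and \<open>s'\<close> are the C-point residuals of a mode before
  and after an iteration, then \<open>s'\<^sub>j = \<mu> s'\<^sub>j\<^sub>-\<^sub>1 + (\<lambda>\<^sup>m - \<mu>) \<lambda>\<^sup>r\<^sup>m s\<^sub>j\<^sub>-\<^sub>1\<^sub>-\<^sub>r\<close>: the scalar operators are polynomials in one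
  shift and commute, so the error recurrence carries over to residuals. Applying the triangle inequality to
  longer and longer prefixes of \<open>s'\<close> bounds its norm by the truncated geometric series in \<open>\<bar>\<mu>\<bar>\<close>.\<close>

section \<open>Blockwise sums, norms of delayed sequences and the bound for the scalar
  recurrence\<close>

lemma sum_blocks:
  fixes f :: "nat \<Rightarrow> 'a :: comm_monoid_add"
  shows "(\<Sum>q<N * n. f q) = (\<Sum>j<N. \<Sum>t<n. f (j * n + t))"
proof -
  have "(\<Sum>t\<in>{j * n..<j * n + n}. f t) = (\<Sum>t<n. f (j * n + t))" for j
    by (simp add: sum.atLeastLessThan_shift_0[of f "j * n"] atLeast0LessThan)
  then show ?thesis by (simp flip: sum.nat_group)
qed

lemma block_index_less:
  fixes b s M n :: nat
  assumes "b < M" and "s < n"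
  shows "b * n + s < M * n"
proof -
  have "b * n + s < Suc b * n" using assms by simp
  also have "\<dots> \<le> M * n" using assms by (intro mult_right_mono) auto
  finally show ?thesis .
qed

lemma L2_set_shift:
  "L2_set (\<lambda>j. if d \<le> j then f (j - d) else 0) {..<p} = L2_set f {..<p - d}" for d p :: nat
proof -
  have "(\<Sum>j<p. (if d \<le> j then f (j - d) else 0)\<^sup>2) = (\<Sum>j\<in>{d..<p}. (f (j - d))\<^sup>2)"
    by (rule sum.mono_neutral_cong_right) auto
  also have "\<dots> = (\<Sum>i<p - d. (f i)\<^sup>2)"
    by (rule sum.reindex_bij_witness[of _ "\<lambda>i. i + d" "\<lambda>j. j - d"]) auto
  finally show ?thesis by (simp add: L2_set_def)
qed

lemma L2_set_lessThan_mono: "p \<le> N \<Longrightarrow> L2_set f {..<p} \<le> L2_set f {..<N}" for p N :: nat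
  unfolding L2_set_def by (intro real_sqrt_le_mono sum_mono2) auto

text \<open>Solving the recurrence writes \<open>s'\<close> as a sum of delayed copies of
  \<open>s\<close>, the copy with weight \<open>K * u ^ i\<close> being delayed by
  \<open>r + 1 + i\<close>. Only delays below \<open>N\<close> are visible, which leaves
  \<open>N - 1 - r\<close> terms; truncated subtraction covers \<open>r \<ge> N - 1\<close>, where
  \<open>s'\<close> vanishes.\<close>

lemma L2_set_recurrence:
  fixes s s' :: "nat \<Rightarrow> complex"
  assumes rec: "\<And>j. j < N \<Longrightarrow> s' j = (if 1 \<le> j then u * s' (j - 1) else 0)
      + (if r + 1 \<le> j then K * s (j - (r + 1)) else 0)"
  shows "L2_set (\<lambda>j. cmod (s' j)) {..<N}
    \<le> cmod K * (\<Sum>i<N - 1 - r. cmod u ^ i) * L2_set (\<lambda>j. cmod (s j)) {..<N}"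
proof -
  let ?S = "L2_set (\<lambda>j. cmod (s j)) {..<N}"
  \<comment> \<open>The induction runs over prefixes of \<open>s'\<close>, while \<open>s\<close> is
    always measured by its full norm \<open>?S\<close>.\<close>
  have "p \<le> N \<Longrightarrow> L2_set (\<lambda>j. cmod (s' j)) {..<p} \<le> cmod K * (\<Sum>i<p - 1 - r. cmod u ^ i) * ?S" for p
  proof (induction p)
    case (Suc p)
    define a where "a = (\<lambda>j. if 1 \<le> j then cmod u * cmod (s' (j - 1)) else 0)"
    define b where "b = (\<lambda>j. if r + 1 \<le> j then cmod K * cmod (s (j - (r + 1))) else 0)"
    \<comment> \<open>A delay by one pushes the last entry out of the prefix of length
      \<open>Suc p\<close>, so the induction hypothesis for \<open>p\<close> applies to what
      remains.\<close>
    have a: "L2_set a {..<Suc p} = cmod u * L2_set (\<lambda>j. cmod (s' j)) {..<p}"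
      unfolding a_def using L2_set_shift[of 1 "\<lambda>j. cmod u * cmod (s' j)" "Suc p"]
      by (simp add: L2_set_right_distrib)
    have b: "L2_set b {..<Suc p} = cmod K * L2_set (\<lambda>j. cmod (s j)) {..<p - r}"
      unfolding b_def using L2_set_shift[of "r + 1" "\<lambda>j. cmod K * cmod (s j)" "Suc p"]
      by (simp add: L2_set_right_distrib)
    have "L2_set (\<lambda>j. cmod (s' j)) {..<Suc p} \<le> L2_set (\<lambda>j. a j + b j) {..<Suc p}"
    proof (rule L2_set_mono)
      fix j assume "j \<in> {..<Suc p}"
      then have "j < N" using Suc.prems by simp
      then have "cmod (s' j) \<le> cmod (if 1 \<le> j then u * s' (j - 1) else 0)
          + cmod (if r + 1 \<le> j then K * s (j - (r + 1)) else 0)"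
        by (metis rec norm_triangle_ineq)
      also have "\<dots> = a j + b j" by (simp add: a_def b_def norm_mult)
      finally show "cmod (s' j) \<le> a j + b j" .
    qed simp
    also have "\<dots> \<le> L2_set a {..<Suc p} + L2_set b {..<Suc p}"
      by (rule L2_set_triangle_ineq)
    also have "\<dots> \<le> cmod K * (\<Sum>i<Suc p - 1 - r. cmod u ^ i) * ?S"
    proof (cases "r < p")
      case True
      then obtain q where q: "p = Suc (r + q)" using less_imp_Suc_add by blast
      have "L2_set b {..<Suc p} \<le> cmod K * ?S"
        unfolding b using Suc.prems by (intro mult_left_mono L2_set_lessThan_mono) auto
      moreover have "L2_set a {..<Suc p} \<le> cmod u * (cmod K * (\<Sum>i<q. cmod u ^ i) * ?S)"
        unfolding a using Suc q by (intro mult_left_mono) auto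
      ultimately have "L2_set a {..<Suc p} + L2_set b {..<Suc p}
          \<le> cmod K * (1 + cmod u * (\<Sum>i<q. cmod u ^ i)) * ?S"
        by (simp add: algebra_simps)
      \<comment> \<open>Horner's rule: each longer prefix adds one term to the geometric
        sum.\<close>
      also have "1 + cmod u * (\<Sum>i<q. cmod u ^ i) = (\<Sum>i<Suc q. cmod u ^ i)"
        by (subst sum.lessThan_Suc_shift) (simp add: sum_distrib_left)
      finally show ?thesis using q by simp
    next
      case False
      \<comment> \<open>For \<open>p \<le> r\<close> the sum in the induction hypothesis is empty,
        so this prefix of \<open>s'\<close> is zero: the delayed \<open>s\<close> has not entered
        yet.\<close>
      then have "L2_set (\<lambda>j. cmod (s' j)) {..<p} = 0"
        using Suc by (intro antisym) auto
      then show ?thesis unfolding a b using False by simp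
    qed
    finally show ?case .
  qed simp
  then show ?thesis by simp
qed

section \<open>Matrix inverses, adjoints and the weighted norm\<close>

text \<open>\<open>mat_inverse\<close> yields \<open>None\<close> only for matrices that are not
  units of the matrix ring, so a left inverse \<open>B\<close> makes \<open>the\<close> meaningful.
  Uniqueness of inverses then identifies the result with \<open>B\<close>.\<close>

lemma minv_inverse:
  assumes A: "A \<in> carrier_mat n n" and B: "B \<in> carrier_mat n n" and "B * A = 1\<^sub>m n"
  shows "minv A \<in> carrier_mat n n" "A * minv A = 1\<^sub>m n" "minv A * A = 1\<^sub>m n" "minv A = B"
proof -
  have AB: "A * B = 1\<^sub>m n" using mat_mult_left_right_inverse[OF B A] assms by simp
  have "A \<in> Units (ring_mat TYPE(complex) n ())"
    using assms AB by (auto simp: Units_def ring_mat_def)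
  then obtain C where C: "mat_inverse A = Some C"
    using mat_inverse(1)[OF A, where b = "()"] by (cases "mat_inverse A") auto
  show *: "minv A \<in> carrier_mat n n" "A * minv A = 1\<^sub>m n" "minv A * A = 1\<^sub>m n"
    using mat_inverse(2)[OF A C] C by auto
  have "minv A = B * A * minv A" using * assms by simp
  also have "\<dots> = B * (A * minv A)" using * A B by (intro assoc_mult_mat) auto
  finally show "minv A = B" using * B by simp
qed

text \<open>Meant for the coarse time-stepping operator: its determinant is easy to find, and no
  explicit inverse has to be written down.\<close>

lemma minv_inverse_of_det:
  assumes A: "A \<in> carrier_mat n n" and "det A \<noteq> 0"
  shows "minv A \<in> carrier_mat n n" "A * minv A = 1\<^sub>m n"
proof -
  have "A \<in> Units (ring_mat TYPE(complex) n ())"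
    by (rule det_non_zero_imp_unit) (use assms in auto)
  then obtain B where B: "B \<in> carrier_mat n n" "B * A = 1\<^sub>m n"
    by (auto simp: Units_def ring_mat_def)
  show "minv A \<in> carrier_mat n n" "A * minv A = 1\<^sub>m n" by (rule minv_inverse[OF A B])+
qed

lemma mat_adjoint_index:
  assumes "A \<in> carrier_mat n m" "i < m" "j < n"
  shows "mat_adjoint A $$ (i, j) = cnj (A $$ (j, i))"
  using assms by (simp add: mat_adjoint_def mat_of_rows_def)

lemma mat_adjoint_carrier: "A \<in> carrier_mat n m \<Longrightarrow> mat_adjoint A \<in> carrier_mat m n"
  by (auto simp: mat_adjoint_def mat_of_rows_def)

lemma mat_adjoint_mult:
  fixes A B :: "complex mat"
  assumes A: "A \<in> carrier_mat n m" and B: "B \<in> carrier_mat m l"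
  shows "mat_adjoint (A * B) = mat_adjoint B * mat_adjoint A"
proof (rule eq_matI)
  note C = mat_adjoint_carrier[OF A] mat_adjoint_carrier[OF B] mult_carrier_mat[OF A B]
  note AB = mat_adjoint_carrier[OF C(3)]
  fix i j assume "i < dim_row (mat_adjoint B * mat_adjoint A)" "j < dim_col (mat_adjoint B * mat_adjoint A)"
  then have ij: "i < l" "j < n" using C by auto
  have "mat_adjoint (A * B) $$ (i, j) = cnj (\<Sum>t<m. A $$ (j, t) * B $$ (t, i))"
    using ij A B mat_adjoint_index[OF C(3), of i j]
    by (simp add: scalar_prod_def atLeast0LessThan)
  also have "\<dots> = (\<Sum>t<m. mat_adjoint B $$ (i, t) * mat_adjoint A $$ (t, j))"
    using ij by (simp add: mat_adjoint_index[OF A] mat_adjoint_index[OF B] mult.commute)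
  also have "\<dots> = (mat_adjoint B * mat_adjoint A) $$ (i, j)"
    using ij C by (simp add: scalar_prod_def atLeast0LessThan)
  finally show "mat_adjoint (A * B) $$ (i, j) = (mat_adjoint B * mat_adjoint A) $$ (i, j)" .
qed (use mat_adjoint_carrier[OF mult_carrier_mat[OF A B]] mat_adjoint_carrier[OF A] mat_adjoint_carrier[OF B] in auto)

lemma mat_adjoint_one: "mat_adjoint (1\<^sub>m n :: complex mat) = 1\<^sub>m n"
proof (rule eq_matI)
  fix i j assume "i < dim_row (1\<^sub>m n :: complex mat)" "j < dim_col (1\<^sub>m n :: complex mat)"
  then show "mat_adjoint (1\<^sub>m n :: complex mat) $$ (i, j) = 1\<^sub>m n $$ (i, j)"
    using mat_adjoint_index[of "1\<^sub>m n" n n i j] by auto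
qed (use mat_adjoint_carrier[of "1\<^sub>m n :: complex mat" n n] in auto)

lemma mat_adjoint_cscalar_prod:
  fixes W :: "complex mat"
  assumes W: "W \<in> carrier_mat n n" and y: "y \<in> carrier_vec n" and x: "x \<in> carrier_vec n"
  shows "(mat_adjoint W *\<^sub>v y) \<bullet>c x = y \<bullet>c (W *\<^sub>v x)"
proof -
  note C = mat_adjoint_carrier[OF W]
  have "(mat_adjoint W *\<^sub>v y) \<bullet>c x = (\<Sum>i<n. (\<Sum>j<n. cnj (W $$ (j, i)) * y $ j) * cnj (x $ i))"
    using C x y mat_adjoint_index[OF W] by (simp add: scalar_prod_def atLeast0LessThan)
  also have "\<dots> = (\<Sum>j<n. \<Sum>i<n. cnj (W $$ (j, i)) * y $ j * cnj (x $ i))"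
    by (subst sum.swap) (simp add: sum_distrib_right)
  also have "\<dots> = y \<bullet>c (W *\<^sub>v x)"
    using W x y by (simp add: scalar_prod_def atLeast0LessThan sum_distrib_left mult_ac)
  finally show ?thesis .
qed

text \<open>As \<open>W\<close> inverts \<open>V\<close>, the weight matrix is the adjoint of
  \<open>W\<close> times \<open>W\<close>, and the quadratic form is the squared l2-norm of
  \<open>W *\<^sub>v x\<close>. The weighted norm thus measures coefficients with respect to the
  columns of \<open>V\<close>.\<close>

lemma eig_norm_eq:
  assumes V: "V \<in> carrier_mat n n" and W: "W \<in> carrier_mat n n" and WV: "W * V = 1\<^sub>m n"
    and x: "x \<in> carrier_vec n"
  shows "eig_norm V x = sqrt (\<Sum>i<n. (cmod ((W *\<^sub>v x) $ i))\<^sup>2)"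
proof -
  note aV = mat_adjoint_carrier[OF V] and aW = mat_adjoint_carrier[OF W]
  have VW: "V * W = 1\<^sub>m n" using mat_mult_left_right_inverse[OF W V WV] .
  have "mat_adjoint W * mat_adjoint V = 1\<^sub>m n"
    using mat_adjoint_mult[OF V W] VW by (simp add: mat_adjoint_one)
  moreover have "W * (V * mat_adjoint V) = mat_adjoint V"
    using assoc_mult_mat[OF W V aV] WV aV by simp
  ultimately have "mat_adjoint W * W * (V * mat_adjoint V) = 1\<^sub>m n"
    using assoc_mult_mat[OF aW W mult_carrier_mat[OF V aV]] by simp
  then have "minv (V * mat_adjoint V) = mat_adjoint W * W"
    using V W aV aW by (intro minv_inverse(4)[of _ n]) auto
  then have "(minv (V * mat_adjoint V) *\<^sub>v x) \<bullet>c x = (W *\<^sub>v x) \<bullet>c (W *\<^sub>v x)"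
    using mat_adjoint_cscalar_prod[OF W _ x, of "W *\<^sub>v x"] W aW x by auto
  also have "\<dots> = of_real (\<Sum>i<n. (cmod ((W *\<^sub>v x) $ i))\<^sup>2)"
    using W x by (simp add: scalar_prod_def atLeast0LessThan complex_norm_square[unfolded of_real_power]
        del: index_mult_mat_vec)
  finally show ?thesis unfolding eig_norm_def by (metis Re_complex_of_real)
qed

section \<open>Block matrices, block coordinates and simultaneous diagonalization\<close>

lemma block_mat_carrier: "block_mat n M N B \<in> carrier_mat (M * n) (N * n)"
  by (simp add: block_mat_def)

lemma block_mat_index:
  assumes "b < M" "s < n" "c < N" "t < n"
  shows "block_mat n M N B $$ (b * n + s, c * n + t) = B b c $$ (s, t)"
  using assms block_index_less[of b M s n] block_index_less[of c N t n] by (simp add: block_mat_def)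

lemma block_mat_mult_vec:
  assumes "x \<in> carrier_vec (N * n)" "b < M" "s < n"
  shows "(block_mat n M N B *\<^sub>v x) $ (b * n + s) = (\<Sum>c<N. \<Sum>t<n. B b c $$ (s, t) * x $ (c * n + t))"
proof -
  have "(block_mat n M N B *\<^sub>v x) $ (b * n + s)
      = (\<Sum>q<N * n. block_mat n M N B $$ (b * n + s, q) * x $ q)"
    using assms block_index_less[of b M s n] block_mat_carrier[of n M N B]
    by (simp add: scalar_prod_def atLeast0LessThan)
  also have "\<dots> = (\<Sum>c<N. \<Sum>t<n. B b c $$ (s, t) * x $ (c * n + t))"
    using assms by (simp add: sum_blocks block_mat_index)
  finally show ?thesis .
qed

text \<open>For \<open>W\<close> the inverse of the eigenvector matrix, this is the component of block \<open>b\<close> of \<open>x\<close> along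
  eigenvector \<open>k\<close>.\<close>
definition block_coord :: "nat \<Rightarrow> complex mat \<Rightarrow> complex vec \<Rightarrow> nat \<Rightarrow> nat \<Rightarrow> complex" where
  "block_coord n W x k b = (\<Sum>s<n. W $$ (k, s) * x $ (b * n + s))"

lemma block_coord_minus:
  assumes "x \<in> carrier_vec (N * n)" "y \<in> carrier_vec (N * n)" "b < N"
  shows "block_coord n W (x - y) k b = block_coord n W x k b - block_coord n W y k b"
  using assms by (auto simp: block_coord_def block_index_less right_diff_distrib sum_subtractf)

lemma block_diag_mult_vec:
  assumes "x \<in> carrier_vec (N * n)" "b < N" "k < n"
  shows "(block_diag n N W *\<^sub>v x) $ (b * n + k) = block_coord n W x k b"
proof -
  have "(block_diag n N W *\<^sub>v x) $ (b * n + k)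
      = (\<Sum>c<N. if c = b then \<Sum>t<n. W $$ (k, t) * x $ (c * n + t) else 0)"
    unfolding block_diag_def block_mat_mult_vec[OF assms] using assms(3)
    by (intro sum.cong) auto
  then show ?thesis using assms(2) by (simp add: block_coord_def)
qed

text \<open>Supplies the inverse that \<open>eig_norm_eq\<close> asks for when the weight is built
  from \<open>block_diag n N U\<close>.\<close>

lemma block_diag_mult:
  assumes U: "U \<in> carrier_mat n n" and W: "W \<in> carrier_mat n n" and "W * U = 1\<^sub>m n"
  shows "block_diag n N W * block_diag n N U = 1\<^sub>m (N * n)"
proof (rule eq_matI)
  fix i j assume "i < dim_row (1\<^sub>m (N * n))" "j < dim_col (1\<^sub>m (N * n))"
  then have ij: "i < N * n" "j < N * n" by auto
  then have "n > 0" by (cases n) auto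
  define b s c t where "b = i div n" and "s = i mod n" and "c = j div n" and "t = j mod n"
  have bs: "b < N" "s < n" "c < N" "t < n" and i: "i = b * n + s" and j: "j = c * n + t"
    using ij \<open>n > 0\<close> by (auto simp: b_def s_def c_def t_def less_mult_imp_div_less)
  have C: "block_diag n N U \<in> carrier_mat (N * n) (N * n)" "block_diag n N W \<in> carrier_mat (N * n) (N * n)"
    by (simp_all add: block_diag_def block_mat_carrier)
  have "(block_diag n N W * block_diag n N U) $$ (i, j) = (block_diag n N W *\<^sub>v col (block_diag n N U) j) $ i"
    using ij C by simp
  also have "\<dots> = block_coord n W (col (block_diag n N U) j) s b"
    unfolding i using C ij bs by (intro block_diag_mult_vec) (auto simp: carrier_vecI)
  also have "\<dots> = (\<Sum>q<n. W $$ (s, q) * (if b = c then U $$ (q, t) else 0))"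
  proof -
    have "col (block_diag n N U) j $ (b * n + q) = (if b = c then U $$ (q, t) else 0)" if "q < n" for q
    proof -
      have "col (block_diag n N U) j $ (b * n + q) = block_diag n N U $$ (b * n + q, j)"
        using C ij bs that block_index_less[of b N q n] by simp
      also have "\<dots> = (if b = c then U $$ (q, t) else 0)"
        unfolding j block_diag_def using bs that by (subst block_mat_index) auto
      finally show ?thesis .
    qed
    then show ?thesis unfolding block_coord_def by (intro sum.cong) auto
  qed
  also have "\<dots> = (if b = c then (W * U) $$ (s, t) else 0)"
    using U W bs by (auto simp: scalar_prod_def atLeast0LessThan)
  also have "\<dots> = 1\<^sub>m (N * n) $$ (i, j)"
  proof (cases "i = j")
    case True
    then show ?thesis using assms(3) bs ij by (simp add: b_def c_def s_def t_def)
  next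
    case False
    then have "b \<noteq> c \<or> s \<noteq> t" using i j by auto
    then show ?thesis using False assms(3) bs ij by auto
  qed
  finally show "(block_diag n N W * block_diag n N U) $$ (i, j) = 1\<^sub>m (N * n) $$ (i, j)" .
qed (auto simp: block_diag_def block_mat_def)

text \<open>A Parseval identity. Exchanging the sums over blocks and eigenvectors puts the modes
  outside, so that each mode can be estimated on its own.\<close>

lemma eig_norm_block_diag:
  assumes U: "U \<in> carrier_mat n n" and W: "W \<in> carrier_mat n n" and "W * U = 1\<^sub>m n"
    and x: "x \<in> carrier_vec (N * n)"
  shows "(eig_norm (block_diag n N U) x)\<^sup>2 = (\<Sum>k<n. (L2_set (\<lambda>b. cmod (block_coord n W x k b)) {..<N})\<^sup>2)"
proof -
  have "(eig_norm (block_diag n N U) x)\<^sup>2 = (\<Sum>i<N * n. (cmod ((block_diag n N W *\<^sub>v x) $ i))\<^sup>2)"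
    using eig_norm_eq[OF _ _ block_diag_mult[OF assms(1-3)] x]
    by (simp add: block_diag_def block_mat_carrier sum_nonneg)
  also have "\<dots> = (\<Sum>b<N. \<Sum>k<n. (cmod (block_coord n W x k b))\<^sup>2)"
    using x by (simp add: sum_blocks block_diag_mult_vec)
  also have "\<dots> = (\<Sum>k<n. (L2_set (\<lambda>b. cmod (block_coord n W x k b)) {..<N})\<^sup>2)"
    by (subst sum.swap) (simp add: L2_set_def sum_nonneg)
  finally show ?thesis .
qed

text \<open>The rows of \<open>W\<close> are left eigenvectors of \<open>B\<close>.\<close>
definition diagonalized_by :: "nat \<Rightarrow> complex mat \<Rightarrow> complex mat \<Rightarrow> (nat \<Rightarrow> complex) \<Rightarrow> bool" where
  "diagonalized_by n W B d \<longleftrightarrow> B \<in> carrier_mat n n \<and> W * B = mat_diag n d * W"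

lemma diagonalized_by_zero:
  assumes "W \<in> carrier_mat n n"
  shows "diagonalized_by n W (0\<^sub>m n n) (\<lambda>_. 0)"
  using assms by (auto simp: diagonalized_by_def mat_diag_mult_left)

lemma diagonalized_by_one:
  assumes "W \<in> carrier_mat n n"
  shows "diagonalized_by n W (1\<^sub>m n) (\<lambda>_. 1)"
  using assms by (simp add: diagonalized_by_def)

lemma diagonalized_by_uminus:
  assumes "W \<in> carrier_mat n n" "diagonalized_by n W B d"
  shows "diagonalized_by n W (- B) (\<lambda>k. - d k)"
proof -
  have "W * - B = - (mat_diag n d * W)"
    using uminus_mult_right_mat[of W B] assms(1)
    by (metis assms(2) carrier_matD diagonalized_by_def)
  also have "\<dots> = mat_diag n (\<lambda>k. - d k) * W"
    using assms(1) by (intro eq_matI) (auto simp: mat_diag_mult_left)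
  finally show ?thesis using assms by (simp add: diagonalized_by_def)
qed

lemma diagonalized_by_pow:
  assumes W: "W \<in> carrier_mat n n" and B: "diagonalized_by n W B d"
  shows "diagonalized_by n W (B ^\<^sub>m p) (\<lambda>k. d k ^ p)"
proof (induction p)
  case 0
  then show ?case using diagonalized_by_one[OF W] B by (auto simp: diagonalized_by_def)
next
  case (Suc p)
  let ?D = "mat_diag n (\<lambda>k. d k ^ p)"
  have B': "B \<in> carrier_mat n n" "B ^\<^sub>m p \<in> carrier_mat n n" using B Suc by (simp_all add: diagonalized_by_def)
  have "W * (B ^\<^sub>m p * B) = W * B ^\<^sub>m p * B" using assoc_mult_mat[OF W B'(2,1)] by simp
  also have "\<dots> = ?D * W * B" using Suc by (simp add: diagonalized_by_def)
  also have "\<dots> = ?D * (mat_diag n d * W)"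
    using assoc_mult_mat[OF mat_diag_dim W B'(1)] B by (simp add: diagonalized_by_def)
  also have "\<dots> = ?D * mat_diag n d * W"
    using assoc_mult_mat[OF mat_diag_dim mat_diag_dim W] by simp
  finally show ?case using mult_carrier_mat[OF B'(2,1)] by (simp add: diagonalized_by_def mult.commute)
qed

text \<open>Row \<open>k\<close> of \<open>W\<close> is a left eigenvector of every block in block
  row \<open>b\<close>, so each block acts on the \<open>k\<close>-th coordinate as the scalar
  \<open>d c k\<close>. This is the decoupling of the modes.\<close>

lemma block_coord_block_mat:
  assumes W: "W \<in> carrier_mat n n" and x: "x \<in> carrier_vec (N * n)" and b: "b < M" and k: "k < n"
    and B: "\<And>c. c < N \<Longrightarrow> diagonalized_by n W (B b c) (d c)"
  shows "block_coord n W (block_mat n M N B *\<^sub>v x) k b = (\<Sum>c<N. d c k * block_coord n W x k c)"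
proof -
  have WB: "(\<Sum>s<n. W $$ (k, s) * B b c $$ (s, t)) = d c k * W $$ (k, t)" if "c < N" "t < n" for c t
  proof -
    have "B b c \<in> carrier_mat n n" using B[OF that(1)] by (simp add: diagonalized_by_def)
    then have "(\<Sum>s<n. W $$ (k, s) * B b c $$ (s, t)) = (W * B b c) $$ (k, t)"
      using W k that by (simp add: scalar_prod_def atLeast0LessThan)
    also have "\<dots> = d c k * W $$ (k, t)"
      using B[OF that(1)] W k that by (simp add: diagonalized_by_def mat_diag_mult_left)
    finally show ?thesis .
  qed
  have "block_coord n W (block_mat n M N B *\<^sub>v x) k b
      = (\<Sum>s<n. \<Sum>c<N. \<Sum>t<n. W $$ (k, s) * B b c $$ (s, t) * x $ (c * n + t))"
    using b unfolding block_coord_def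
    by (intro sum.cong) (simp_all add: block_mat_mult_vec[OF x] sum_distrib_left mult.assoc)
  also have "\<dots> = (\<Sum>c<N. \<Sum>s<n. \<Sum>t<n. W $$ (k, s) * B b c $$ (s, t) * x $ (c * n + t))"
    by (rule sum.swap)
  also have "\<dots> = (\<Sum>c<N. \<Sum>t<n. (\<Sum>s<n. W $$ (k, s) * B b c $$ (s, t)) * x $ (c * n + t))"
    unfolding sum_distrib_right by (intro sum.cong refl sum.swap)
  also have "\<dots> = (\<Sum>c<N. d c k * block_coord n W x k c)"
    by (simp add: WB block_coord_def sum_distrib_left mult.assoc)
  finally show ?thesis .
qed

section \<open>The time-stepping operator: its modes and its determinant\<close>

lemma block_coord_time_op:
  assumes W: "W \<in> carrier_mat n n" and \<Phi>: "diagonalized_by n W \<Phi> \<mu>"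
    and x: "x \<in> carrier_vec (N * n)" and b: "b < N" and k: "k < n"
  shows "block_coord n W (time_op n N \<Phi> *\<^sub>v x) k b
    = block_coord n W x k b - (if 1 \<le> b then \<mu> k * block_coord n W x k (b - 1) else 0)"
proof -
  let ?d = "\<lambda>c. if b = c then (\<lambda>_. 1) else if b = c + 1 then (\<lambda>k. - \<mu> k) else (\<lambda>_. 0)"
  have "block_coord n W (time_op n N \<Phi> *\<^sub>v x) k b = (\<Sum>c<N. ?d c k * block_coord n W x k c)"
    unfolding time_op_def
    using diagonalized_by_zero[OF W] diagonalized_by_one[OF W] diagonalized_by_uminus[OF W \<Phi>]
    by (intro block_coord_block_mat[OF W x b k]) auto
  also have "\<dots> = (\<Sum>c<N. (if c = b then block_coord n W x k c else 0)
      - (if c + 1 = b then \<mu> k * block_coord n W x k c else 0))"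
    by (intro sum.cong) auto
  also have "\<dots> = block_coord n W x k b - (if 1 \<le> b then \<mu> k * block_coord n W x k (b - 1) else 0)"
    using b by (cases b) (auto simp: sum_subtractf)
  finally show ?thesis .
qed

text \<open>The diagonal blocks are identities and all blocks above them are zero, so the scalar
  matrix is unit lower triangular. Invertibility of the coarse operator follows.\<close>

lemma det_time_op: "det (time_op n N \<Phi>) = 1"
proof -
  have A: "time_op n N \<Phi> \<in> carrier_mat (N * n) (N * n)" by (simp add: time_op_def block_mat_carrier)
  have diag: "time_op n N \<Phi> $$ (i, i) = 1" if "i < N * n" for i
  proof -
    have "n > 0" using that by (cases n) auto
    then show ?thesis using that by (simp add: time_op_def block_mat_def)
  qed
  have "time_op n N \<Phi> $$ (i, j) = 0" if ij: "i < j" "j < N * n" for i j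
  proof -
    have "n > 0" using ij by (cases n) auto
    moreover have "i div n \<le> j div n" using ij by (simp add: div_le_mono)
    \<comment> \<open>Inside a diagonal block, \<open>i < j\<close> means an off-diagonal position
      of the identity.\<close>
    moreover have "i mod n \<noteq> j mod n" if "i div n = j div n"
      using that ij by (metis div_mult_mod_eq less_irrefl)
    ultimately show ?thesis using ij by (auto simp: time_op_def block_mat_def)
  qed
  then have "det (time_op n N \<Phi>) = prod_list (diag_mat (time_op n N \<Phi>))"
    using A by (intro det_lower_triangular) auto
  also have "diag_mat (time_op n N \<Phi>) = map (\<lambda>_. 1) [0..<N * n]"
    using A diag by (auto simp: diag_mat_def)
  finally show ?thesis by (simp add: map_replicate_const)
qed

section \<open>The MGRIT operators mode by mode\<close>

text \<open>\<open>L\<close> counts the coarse time intervals; through it the divisibility condition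
  on the grid sizes becomes an equation.\<close>

locale mgrit =
  fixes n m L N\<^sub>0 N\<^sub>1 :: nat and W \<Phi>\<^sub>0 \<Phi>\<^sub>1 :: "complex mat" and \<mu>\<^sub>0 \<mu>\<^sub>1 :: "nat \<Rightarrow> complex"
  assumes m: "1 \<le> m" and N\<^sub>0: "N\<^sub>0 = L * m + 1" and N\<^sub>1: "N\<^sub>1 = L + 1"
    and W: "W \<in> carrier_mat n n"
    and \<Phi>\<^sub>0: "diagonalized_by n W \<Phi>\<^sub>0 \<mu>\<^sub>0" and \<Phi>\<^sub>1: "diagonalized_by n W \<Phi>\<^sub>1 \<mu>\<^sub>1"
begin

abbreviation "A\<^sub>0 \<equiv> time_op n N\<^sub>0 \<Phi>\<^sub>0"
abbreviation "A\<^sub>1 \<equiv> time_op n N\<^sub>1 \<Phi>\<^sub>1"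
abbreviation "R \<equiv> ideal_restr n m N\<^sub>0 \<Phi>\<^sub>0"
abbreviation "P \<equiv> ideal_interp n m N\<^sub>0 \<Phi>\<^sub>0"
abbreviation "R\<^sub>I \<equiv> inj_restr n m N\<^sub>0"
abbreviation "coord \<equiv> block_coord n W"

lemma coarse_points: "coarse_points m N\<^sub>0 = N\<^sub>1"
  using m by (simp add: coarse_points_def N\<^sub>0 N\<^sub>1)

lemma C_point_less: "j < N\<^sub>1 \<Longrightarrow> j * m < N\<^sub>0"
  by (simp add: N\<^sub>0 N\<^sub>1 less_Suc_eq_le)

lemma C_interval_less: "b < N\<^sub>0 \<Longrightarrow> b div m < N\<^sub>1"
  using m div_le_mono[of b "L * m" m] by (simp add: N\<^sub>0 N\<^sub>1 less_Suc_eq_le)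

lemma carriers:
  "A\<^sub>0 \<in> carrier_mat (N\<^sub>0 * n) (N\<^sub>0 * n)" "A\<^sub>1 \<in> carrier_mat (N\<^sub>1 * n) (N\<^sub>1 * n)"
  "R \<in> carrier_mat (N\<^sub>1 * n) (N\<^sub>0 * n)" "P \<in> carrier_mat (N\<^sub>0 * n) (N\<^sub>1 * n)"
  "R\<^sub>I \<in> carrier_mat (N\<^sub>1 * n) (N\<^sub>0 * n)"
  unfolding time_op_def ideal_restr_def ideal_interp_def inj_restr_def coarse_points
  by (rule block_mat_carrier)+

text \<open>The intervals starting at C-points partition the fine grid, so block row
  \<open>b\<close> has a single nonzero entry per mode at most, in column \<open>b div m\<close>:
  the C-point value is propagated \<open>b mod m\<close> steps.\<close>

lemma coord_interp:
  assumes c: "c \<in> carrier_vec (N\<^sub>1 * n)" and b: "b < N\<^sub>0" and k: "k < n"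
  shows "coord (P *\<^sub>v c) k b = \<mu>\<^sub>0 k ^ (b mod m) * coord c k (b div m)"
proof -
  let ?d = "\<lambda>j. if b \<in> {j * m..<j * m + m} then (\<lambda>k. \<mu>\<^sub>0 k ^ (b - j * m)) else (\<lambda>_. 0)"
  have iff: "b \<in> {j * m..<j * m + m} \<longleftrightarrow> j = b div m" for j
  proof
    assume "b \<in> {j * m..<j * m + m}"
    then show "j = b div m" by (intro div_nat_eqI[symmetric]) (auto simp: mult.commute)
  next
    assume "j = b div m"
    then show "b \<in> {j * m..<j * m + m}" using m dividend_less_div_times[of m b] by simp
  qed
  have "coord (P *\<^sub>v c) k b = (\<Sum>j<N\<^sub>1. ?d j k * coord c k j)"
    unfolding ideal_interp_def coarse_points
    using diagonalized_by_zero[OF W] diagonalized_by_pow[OF W \<Phi>\<^sub>0]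
    by (intro block_coord_block_mat[OF W c b k]) auto
  also have "\<dots> = (\<Sum>j<N\<^sub>1. if j = b div m then \<mu>\<^sub>0 k ^ (b mod m) * coord c k j else 0)"
    unfolding iff by (intro sum.cong) (auto simp: minus_div_mult_eq_mod)
  also have "\<dots> = \<mu>\<^sub>0 k ^ (b mod m) * coord c k (b div m)"
    using C_interval_less[OF b] by simp
  finally show ?thesis .
qed

lemma coord_inj:
  assumes x: "x \<in> carrier_vec (N\<^sub>0 * n)" and j: "j < N\<^sub>1" and k: "k < n"
  shows "coord (R\<^sub>I *\<^sub>v x) k j = coord x k (j * m)"
proof -
  have "coord (R\<^sub>I *\<^sub>v x) k j = (\<Sum>c<N\<^sub>0. (if c = j * m then (\<lambda>_. 1) else (\<lambda>_. 0)) k * coord x k c)"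
    unfolding inj_restr_def coarse_points
    using diagonalized_by_zero[OF W] diagonalized_by_one[OF W]
    by (intro block_coord_block_mat[OF W x j k]) auto
  also have "\<dots> = (\<Sum>c<N\<^sub>0. if c = j * m then coord x k c else 0)"
    by (intro sum.cong) auto
  also have "\<dots> = coord x k (j * m)" using C_point_less[OF j] by simp
  finally show ?thesis .
qed

text \<open>Apart from F-points, where \<open>x\<close> vanishes in this mode, block row
  \<open>j\<close> sees only the C-point \<open>j * m\<close>, with weight
  \<open>\<mu>\<^sub>0 k ^ 0\<close>. On such vectors the ideal restriction is therefore
  injection.\<close>

lemma coord_restr:
  assumes x: "x \<in> carrier_vec (N\<^sub>0 * n)" and j: "j < N\<^sub>1" and k: "k < n"
    and F: "\<And>b. b < N\<^sub>0 \<Longrightarrow> \<not> m dvd b \<Longrightarrow> coord x k b = 0"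
  shows "coord (R *\<^sub>v x) k j = coord x k (j * m)"
proof -
  let ?d = "\<lambda>c. if j = 0 then (if c = 0 then (\<lambda>_. 1) else (\<lambda>_. 0))
    else if c \<in> {(j - 1) * m + 1..(j - 1) * m + m} then (\<lambda>k. \<mu>\<^sub>0 k ^ (m - (c - (j - 1) * m))) else (\<lambda>_. 0)"
  have "coord (R *\<^sub>v x) k j = (\<Sum>c<N\<^sub>0. ?d c k * coord x k c)"
    unfolding ideal_restr_def coarse_points
    using diagonalized_by_zero[OF W] diagonalized_by_one[OF W] diagonalized_by_pow[OF W \<Phi>\<^sub>0]
    by (intro block_coord_block_mat[OF W x j k]) auto
  also have "\<dots> = (\<Sum>c<N\<^sub>0. if c = j * m then coord x k c else 0)"
  proof (intro sum.cong refl)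
    fix c assume c: "c \<in> {..<N\<^sub>0}"
    show "?d c k * coord x k c = (if c = j * m then coord x k c else 0)"
    proof (cases "m dvd c")
      case False
      then show ?thesis using F[of c] c by auto
    next
      case True
      then obtain q where q: "c = q * m" by (metis dvd_def mult.commute)
      show ?thesis
      proof (cases j)
        case 0
        then show ?thesis by simp
      next
        case (Suc i)
        \<comment> \<open>The window leaves out its left end \<open>i * m\<close>, so the next
          multiple of \<open>m\<close> is the only one in it.\<close>
        have "c \<in> {i * m + 1..i * m + m} \<longleftrightarrow> q = Suc i"
        proof
          assume A: "c \<in> {i * m + 1..i * m + m}"
          then have "i * m < q * m" "q * m < Suc (Suc i) * m"
            using m unfolding q atLeastAtMost_iff mult_Suc by linarith+
          then have "i < q" "q < Suc (Suc i)" unfolding mult_less_cancel2 by blast+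
          then show "q = Suc i" by simp
        qed (use q m in simp)
        then show ?thesis using q m Suc by auto
      qed
    qed
  qed
  also have "\<dots> = coord x k (j * m)" using C_point_less[OF j] by simp
  finally show ?thesis .
qed

text \<open>Interpolation steps exactly within an interval, which cancels the residual at F-points.
  At a later C-point the predecessor is the last point of the previous interval, carrying
  \<open>m - 1\<close> powers of the eigenvalue; the operator adds one more.\<close>

lemma coord_fine_interp:
  assumes c: "c \<in> carrier_vec (N\<^sub>1 * n)" and b: "b < N\<^sub>0" and k: "k < n"
  shows "coord (A\<^sub>0 *\<^sub>v (P *\<^sub>v c)) k b = (if m dvd b then
    coord c k (b div m) - (if 1 \<le> b then \<mu>\<^sub>0 k ^ m * coord c k (b div m - 1) else 0) else 0)"
proof -
  have Pc: "P *\<^sub>v c \<in> carrier_vec (N\<^sub>0 * n)" using carriers c by auto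
  have *: "coord (A\<^sub>0 *\<^sub>v (P *\<^sub>v c)) k b = \<mu>\<^sub>0 k ^ (b mod m) * coord c k (b div m)
      - (if 1 \<le> b then \<mu>\<^sub>0 k * (\<mu>\<^sub>0 k ^ ((b - 1) mod m) * coord c k ((b - 1) div m)) else 0)"
    using b by (simp add: block_coord_time_op[OF W \<Phi>\<^sub>0 Pc b k] coord_interp[OF c _ k])
  show ?thesis
  proof (cases b)
    case 0
    then show ?thesis using * by simp
  next
    case (Suc b')
    show ?thesis
    proof (cases "m dvd b")
      case True
      \<comment> \<open>The predecessor of a positive multiple of \<open>m\<close> has remainder
        \<open>m - 1\<close> and lies one interval earlier.\<close>
      then have "Suc (b' mod m) = m" "Suc (b' div m) = b div m"
        using m Suc mod_Suc[of b' m] div_Suc[of b' m] by (auto split: if_splits)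
      then have "\<mu>\<^sub>0 k ^ m = \<mu>\<^sub>0 k * \<mu>\<^sub>0 k ^ (b' mod m)" "b div m - 1 = b' div m"
        by (metis power_Suc, simp)
      then show ?thesis using * True Suc by simp
    next
      case False
      then have "b mod m = Suc (b' mod m)" "b' div m = b div m"
        using m Suc mod_Suc[of b' m] div_Suc[of b' m] by (auto split: if_splits)
      then show ?thesis using * False Suc by simp
    qed
  qed
qed

text \<open>The residual of an interpolated vector vanishes at F-points, so restriction just injects
  it. The result is the ideal coarse operator, which takes \<open>m\<close> fine steps at
  once.\<close>

lemma coord_coarse_residual:
  assumes c: "c \<in> carrier_vec (N\<^sub>1 * n)" and j: "j < N\<^sub>1" and k: "k < n"
  shows "coord (R *\<^sub>v (A\<^sub>0 *\<^sub>v (P *\<^sub>v c))) k j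
    = coord c k j - (if 1 \<le> j then \<mu>\<^sub>0 k ^ m * coord c k (j - 1) else 0)"
proof -
  have "A\<^sub>0 *\<^sub>v (P *\<^sub>v c) \<in> carrier_vec (N\<^sub>0 * n)" using carriers c by auto
  then have "coord (R *\<^sub>v (A\<^sub>0 *\<^sub>v (P *\<^sub>v c))) k j = coord (A\<^sub>0 *\<^sub>v (P *\<^sub>v c)) k (j * m)"
    by (intro coord_restr[OF _ j k]) (simp_all add: coord_fine_interp[OF c _ k])
  also have "\<dots> = coord c k j - (if 1 \<le> j then \<mu>\<^sub>0 k ^ m * coord c k (j - 1) else 0)"
    using m by (auto simp: coord_fine_interp[OF c C_point_less[OF j] k])
  finally show ?thesis .
qed

text \<open>By \<open>coord_coarse_residual\<close>, one relaxation step is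
  \<open>\<mu>\<^sub>0 k ^ m\<close> times the shift by one C-point, with zero entering at the
  start; its powers are then explicit.\<close>

lemma coord_relaxation:
  assumes c: "c \<in> carrier_vec (N\<^sub>1 * n)" and j: "j < N\<^sub>1" and k: "k < n"
  shows "coord ((1\<^sub>m (N\<^sub>1 * n) - R * A\<^sub>0 * P) ^\<^sub>m r *\<^sub>v c) k j
    = (if r \<le> j then \<mu>\<^sub>0 k ^ (r * m) * coord c k (j - r) else 0)"
  using c j
proof (induction r arbitrary: c)
  case 0
  then show ?case using carriers by (simp del: index_mult_mat_vec)
next
  case (Suc r)
  let ?T = "1\<^sub>m (N\<^sub>1 * n) - R * A\<^sub>0 * P"
  have RAP: "R * A\<^sub>0 * P \<in> carrier_mat (N\<^sub>1 * n) (N\<^sub>1 * n)"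
    by (rule mult_carrier_mat[OF mult_carrier_mat[OF carriers(3,1)] carriers(4)])
  then have T: "?T \<in> carrier_mat (N\<^sub>1 * n) (N\<^sub>1 * n)" by (rule minus_carrier_mat)
  have Pc: "P *\<^sub>v c \<in> carrier_vec (N\<^sub>0 * n)" using carriers Suc.prems by auto
  have Tc: "?T *\<^sub>v c = c - R *\<^sub>v (A\<^sub>0 *\<^sub>v (P *\<^sub>v c))"
    using minus_mult_distrib_mat_vec[OF one_carrier_mat RAP Suc.prems(1)] Suc.prems(1)
      assoc_mult_mat_vec[OF mult_carrier_mat[OF carriers(3,1)] carriers(4) Suc.prems(1)]
      assoc_mult_mat_vec[OF carriers(3,1) Pc] by simp
  have step: "coord (?T *\<^sub>v c) k i = (if 1 \<le> i then \<mu>\<^sub>0 k ^ m * coord c k (i - 1) else 0)" if "i < N\<^sub>1" for i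
  proof -
    have RAPc: "R *\<^sub>v (A\<^sub>0 *\<^sub>v (P *\<^sub>v c)) \<in> carrier_vec (N\<^sub>1 * n)" using carriers Pc by auto
    show ?thesis
      unfolding Tc block_coord_minus[OF Suc.prems(1) RAPc that]
      by (simp add: coord_coarse_residual[OF Suc.prems(1) that k])
  qed
  \<comment> \<open>The power peels off a factor on the right, so the induction hypothesis is
    applied to \<open>?T *\<^sub>v c\<close>; hence \<open>c\<close> is generalized.\<close>
  have "coord (?T ^\<^sub>m Suc r *\<^sub>v c) k j = coord (?T ^\<^sub>m r *\<^sub>v (?T *\<^sub>v c)) k j"
    using assoc_mult_mat_vec[OF pow_carrier_mat[OF T] T Suc.prems(1)] by simp
  also have "\<dots> = (if r \<le> j then \<mu>\<^sub>0 k ^ (r * m) * coord (?T *\<^sub>v c) k (j - r) else 0)"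
    using T Suc.prems by (intro Suc.IH) auto
  also have "\<dots> = (if Suc r \<le> j then \<mu>\<^sub>0 k ^ (Suc r * m) * coord c k (j - Suc r) else 0)"
    using Suc.prems by (auto simp: step power_add)
  finally show ?case .
qed

text \<open>The new error is interpolated from C-points, so its residual vanishes at F-points for
  every \<open>e\<close>. With \<open>S\<close> the shift, \<open>v\<close> the new error at
  C-points and \<open>c\<close> the relaxed one,
  \<open>(1 - \<mu> S) v = (\<lambda>^m - \<mu>) S c\<close>; applying
  \<open>1 - \<lambda>^m S\<close> turns \<open>v\<close> into the new residual and \<open>c\<close>
  into the delayed old one.\<close>

lemma residual_step:
  fixes r :: nat and e :: "complex vec"
  assumes e: "e \<in> carrier_vec (N\<^sub>0 * n)"
  defines "e' \<equiv> mgrit_err_prop n m N\<^sub>0 \<Phi>\<^sub>0 \<Phi>\<^sub>1 r *\<^sub>v e"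
  shows "e' \<in> carrier_vec (N\<^sub>0 * n)"
    and "\<And>b k. b < N\<^sub>0 \<Longrightarrow> k < n \<Longrightarrow> \<not> m dvd b \<Longrightarrow> coord (A\<^sub>0 *\<^sub>v e') k b = 0"
    and "\<And>j k. j < N\<^sub>1 \<Longrightarrow> k < n \<Longrightarrow> (\<And>b. b < N\<^sub>0 \<Longrightarrow> \<not> m dvd b \<Longrightarrow> coord (A\<^sub>0 *\<^sub>v e) k b = 0) \<Longrightarrow>
      coord (A\<^sub>0 *\<^sub>v e') k (j * m)
      = (if 1 \<le> j then \<mu>\<^sub>1 k * coord (A\<^sub>0 *\<^sub>v e') k ((j - 1) * m) else 0)
        + (if r + 1 \<le> j then (\<mu>\<^sub>0 k ^ m - \<mu>\<^sub>1 k) * \<mu>\<^sub>0 k ^ (r * m) * coord (A\<^sub>0 *\<^sub>v e) k ((j - (r + 1)) * m) else 0)"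
proof -
  let ?T = "1\<^sub>m (N\<^sub>1 * n) - R * A\<^sub>0 * P"
  \<comment> \<open>\<open>c\<close> is the C-point error after relaxation, \<open>w\<close> the
    coarse-grid correction and \<open>v\<close> the corrected C-point error.\<close>
  define c where "c = ?T ^\<^sub>m r *\<^sub>v (R\<^sub>I *\<^sub>v e)"
  define w where "w = minv A\<^sub>1 *\<^sub>v (R *\<^sub>v (A\<^sub>0 *\<^sub>v (P *\<^sub>v c)))"
  define v where "v = c - w"
  have A\<^sub>1i: "minv A\<^sub>1 \<in> carrier_mat (N\<^sub>1 * n) (N\<^sub>1 * n)" "A\<^sub>1 * minv A\<^sub>1 = 1\<^sub>m (N\<^sub>1 * n)"
    using minv_inverse_of_det[OF carriers(2)] by (simp_all add: det_time_op)
  note PA = mult_carrier_mat[OF carriers(4) A\<^sub>1i(1)]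
  note PAR = mult_carrier_mat[OF PA carriers(3)]
  note PARA = mult_carrier_mat[OF PAR carriers(1)]
  have T: "?T \<in> carrier_mat (N\<^sub>1 * n) (N\<^sub>1 * n)"
    by (rule minus_carrier_mat, rule mult_carrier_mat[OF mult_carrier_mat[OF carriers(3,1)] carriers(4)])
  have RIe: "R\<^sub>I *\<^sub>v e \<in> carrier_vec (N\<^sub>1 * n)" using carriers e by auto
  have c: "c \<in> carrier_vec (N\<^sub>1 * n)"
    unfolding c_def using mult_mat_vec_carrier[OF pow_carrier_mat[OF T] RIe] .
  have Pc: "P *\<^sub>v c \<in> carrier_vec (N\<^sub>0 * n)" using mult_mat_vec_carrier[OF carriers(4) c] .
  have APc: "A\<^sub>0 *\<^sub>v (P *\<^sub>v c) \<in> carrier_vec (N\<^sub>0 * n)" using mult_mat_vec_carrier[OF carriers(1) Pc] .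
  have RAPc: "R *\<^sub>v (A\<^sub>0 *\<^sub>v (P *\<^sub>v c)) \<in> carrier_vec (N\<^sub>1 * n)" using mult_mat_vec_carrier[OF carriers(3) APc] .
  have w: "w \<in> carrier_vec (N\<^sub>1 * n)" unfolding w_def using mult_mat_vec_carrier[OF A\<^sub>1i(1) RAPc] .
  have v: "v \<in> carrier_vec (N\<^sub>1 * n)" using c w by (simp add: v_def)
  have I: "1\<^sub>m (N\<^sub>0 * n) - P * minv A\<^sub>1 * R * A\<^sub>0 \<in> carrier_mat (N\<^sub>0 * n) (N\<^sub>0 * n)"
    by (rule minus_carrier_mat[OF PARA])
  have "e' = (1\<^sub>m (N\<^sub>0 * n) - P * minv A\<^sub>1 * R * A\<^sub>0) *\<^sub>v (P *\<^sub>v c)"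
    unfolding e'_def mgrit_err_prop_def coarse_points Let_def c_def
    using assoc_mult_mat_vec[OF I carriers(4) c]
      assoc_mult_mat_vec[OF mult_carrier_mat[OF I carriers(4)] pow_carrier_mat[OF T] RIe]
      assoc_mult_mat_vec[OF mult_carrier_mat[OF mult_carrier_mat[OF I carriers(4)] pow_carrier_mat[OF T]] carriers(5) e]
    by (simp add: c_def)
  also have "\<dots> = P *\<^sub>v c - P *\<^sub>v w"
    unfolding w_def
    using minus_mult_distrib_mat_vec[OF one_carrier_mat PARA Pc] Pc
      assoc_mult_mat_vec[OF PAR carriers(1) Pc] assoc_mult_mat_vec[OF PA carriers(3) APc]
      assoc_mult_mat_vec[OF carriers(4) A\<^sub>1i(1) RAPc] by simp
  also have "\<dots> = P *\<^sub>v v"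
    unfolding v_def using mult_minus_distrib_mat_vec[OF carriers(4) c w] by simp
  finally have e': "e' = P *\<^sub>v v" .
  show "e' \<in> carrier_vec (N\<^sub>0 * n)" unfolding e' using mult_mat_vec_carrier[OF carriers(4) v] .
  show "coord (A\<^sub>0 *\<^sub>v e') k b = 0" if "b < N\<^sub>0" "k < n" "\<not> m dvd b" for b k
    using that by (simp add: e' coord_fine_interp[OF v])
  show "coord (A\<^sub>0 *\<^sub>v e') k (j * m)
      = (if 1 \<le> j then \<mu>\<^sub>1 k * coord (A\<^sub>0 *\<^sub>v e') k ((j - 1) * m) else 0)
        + (if r + 1 \<le> j then (\<mu>\<^sub>0 k ^ m - \<mu>\<^sub>1 k) * \<mu>\<^sub>0 k ^ (r * m) * coord (A\<^sub>0 *\<^sub>v e) k ((j - (r + 1)) * m) else 0)"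
    if j: "j < N\<^sub>1" and k: "k < n"
      and F: "\<And>b. b < N\<^sub>0 \<Longrightarrow> \<not> m dvd b \<Longrightarrow> coord (A\<^sub>0 *\<^sub>v e) k b = 0" for j k
  proof -
    let ?l = "\<mu>\<^sub>0 k" and ?u = "\<mu>\<^sub>1 k"
    let ?s = "\<lambda>j. coord (A\<^sub>0 *\<^sub>v e) k (j * m)"
    have "A\<^sub>1 *\<^sub>v w = R *\<^sub>v (A\<^sub>0 *\<^sub>v (P *\<^sub>v c))"
      unfolding w_def using assoc_mult_mat_vec[OF carriers(2) A\<^sub>1i(1) RAPc] A\<^sub>1i(2) RAPc by simp
    then have w_rec: "coord w k i - (if 1 \<le> i then ?u * coord w k (i - 1) else 0)
        = coord c k i - (if 1 \<le> i then ?l ^ m * coord c k (i - 1) else 0)" if "i < N\<^sub>1" for i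
      using block_coord_time_op[OF W \<Phi>\<^sub>1 w that k] coord_coarse_residual[OF c that k] by simp
    \<comment> \<open>Since \<open>v = c - w\<close>, subtracting \<open>w_rec\<close> from the
      coarse operator applied to \<open>c\<close> leaves only the difference of the two propagators,
      one step back.\<close>
    have v_rec: "coord v k i = (if 1 \<le> i then ?u * coord v k (i - 1)
        + (?l ^ m - ?u) * coord c k (i - 1) else 0)" if "i < N\<^sub>1" for i
      using w_rec[OF that] that unfolding v_def
      by (cases i) (simp_all add: block_coord_minus[OF c w] algebra_simps)
    have res': "coord (A\<^sub>0 *\<^sub>v e') k (i * m) = coord v k i - (if 1 \<le> i then ?l ^ m * coord v k (i - 1) else 0)"
      if "i < N\<^sub>1" for i
      using m by (auto simp: e' coord_fine_interp[OF v C_point_less[OF that] k])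
    have e_rec: "coord e k b = ?l * coord e k (b - 1) + coord (A\<^sub>0 *\<^sub>v e) k b" if "b < N\<^sub>0" "1 \<le> b" for b
      using block_coord_time_op[OF W \<Phi>\<^sub>0 e that(1) k] that(2) by simp
    \<comment> \<open>The old residual is zero at F-points, so from each C-point the old error is
      propagated freely through its interval.\<close>
    have e_F: "coord e k (i * m + t) = ?l ^ t * coord e k (i * m)" if "i * m + t < N\<^sub>0" "t < m" for i t
      using that
    proof (induction t)
      case (Suc t)
      have "\<not> m dvd i * m + Suc t" using Suc.prems(2)
        by (metis dvd_add_right_iff dvd_triv_right nat_dvd_not_less zero_less_Suc)
      then show ?case using Suc e_rec[of "i * m + Suc t"] F[of "i * m + Suc t"] by simp
    qed simp
    have e_C: "coord e k (Suc i * m) - ?l ^ m * coord e k (i * m) = ?s (Suc i)" if "Suc i < N\<^sub>1" for i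
    proof -
      obtain p where p: "m = Suc p" using m by (cases m) auto
      then have idx: "Suc i * m - 1 = i * m + p" "1 \<le> Suc i * m" "i * m + p < Suc i * m" by simp_all
      have "coord e k (Suc i * m) = ?l * (?l ^ p * coord e k (i * m)) + ?s (Suc i)"
        using e_rec[OF C_point_less[OF that] idx(2)] e_F[of i p] idx(1,3) C_point_less[OF that] p
        by (metis lessI less_trans)
      then show ?thesis by (simp add: p)
    qed
    have e_0: "coord e k 0 = ?s 0"
      using block_coord_time_op[OF W \<Phi>\<^sub>0 e C_point_less[OF j, THEN le_less_trans[OF le0]] k] by simp
    have c_eq: "coord c k i = (if r \<le> i then ?l ^ (r * m) * coord e k ((i - r) * m) else 0)" if "i < N\<^sub>1" for i
      unfolding c_def coord_relaxation[OF RIe that k] using that by (simp add: coord_inj[OF e _ k])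
    \<comment> \<open>Relaxation commutes with the ideal coarse operator, which maps the C-point
      error to the C-point residual. At \<open>i = r\<close> the initial value \<open>e_0\<close>
      enters; before that everything is zero.\<close>
    have c_rec: "coord c k i - (if 1 \<le> i then ?l ^ m * coord c k (i - 1) else 0)
        = (if r \<le> i then ?l ^ (r * m) * ?s (i - r) else 0)" if "i < N\<^sub>1" for i
    proof (cases "r < i")
      case True
      then obtain q where q: "i = Suc (r + q)" using less_imp_Suc_add by blast
      have "coord c k i - (if 1 \<le> i then ?l ^ m * coord c k (i - 1) else 0)
          = ?l ^ (r * m) * (coord e k (Suc q * m) - ?l ^ m * coord e k (q * m))"
        using that by (simp add: q c_eq algebra_simps del: mult_Suc)
      also have "\<dots> = ?l ^ (r * m) * ?s (Suc q)" using e_C[of q] that q by simp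
      finally show ?thesis by (simp add: q)
    next
      case False
      then show ?thesis using that by (auto simp: c_eq e_0)
    qed
    show ?thesis
    proof (cases j)
      case 0
      then show ?thesis using res'[of 0] v_rec[of 0] j by simp
    next
      case (Suc i)
      have i: "i < N\<^sub>1" using j Suc by simp
      \<comment> \<open>Subtracting \<open>?l ^ m\<close> times \<open>v_rec\<close> at
        \<open>i\<close> from \<open>v_rec\<close> at \<open>j\<close> removes \<open>v\<close> in
        favour of residuals.\<close>
      have "coord (A\<^sub>0 *\<^sub>v e') k (j * m) = ?u * coord (A\<^sub>0 *\<^sub>v e') k (i * m)
          + (?l ^ m - ?u) * (coord c k i - (if 1 \<le> i then ?l ^ m * coord c k (i - 1) else 0))"
        unfolding res'[OF j] res'[OF i] using v_rec[OF j] arg_cong[OF v_rec[OF i], of "\<lambda>z. ?l ^ m * z"] Suc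
        by (cases "1 \<le> i") (simp_all add: algebra_simps)
      then show ?thesis unfolding c_rec[OF i] using Suc by simp
    qed
  qed
qed

lemma L2_set_C_points:
  assumes F: "\<And>b. b < N\<^sub>0 \<Longrightarrow> \<not> m dvd b \<Longrightarrow> f b = 0"
  shows "L2_set f {..<N\<^sub>0} = L2_set (\<lambda>j. f (j * m)) {..<N\<^sub>1}"
proof -
  have "(\<Sum>b<N\<^sub>0. (f b)\<^sup>2) = (\<Sum>b\<in>(\<lambda>j. j * m) ` {..<N\<^sub>1}. (f b)\<^sup>2)"
  proof (rule sum.mono_neutral_right)
    show "\<forall>b\<in>{..<N\<^sub>0} - (\<lambda>j. j * m) ` {..<N\<^sub>1}. (f b)\<^sup>2 = 0"
    proof
      fix b assume b: "b \<in> {..<N\<^sub>0} - (\<lambda>j. j * m) ` {..<N\<^sub>1}"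
      have "\<not> m dvd b"
      proof
        assume "m dvd b"
        then have "b = b div m * m" by simp
        then show False using b C_interval_less[of b] by blast
      qed
      then show "(f b)\<^sup>2 = 0" using F b by simp
    qed
  qed (auto simp: C_point_less)
  also have "\<dots> = (\<Sum>j<N\<^sub>1. (f (j * m))\<^sup>2)"
    using m by (subst sum.reindex) (auto simp: inj_on_def)
  finally show ?thesis by (simp add: L2_set_def)
qed

text \<open>Both residuals live on C-points, so the norm over the fine grid is the norm over the
  coarse one, to which \<open>L2_set_recurrence\<close> applies.\<close>

lemma L2_set_step:
  assumes e: "e \<in> carrier_vec (N\<^sub>0 * n)" and k: "k < n"
    and F: "\<And>b. b < N\<^sub>0 \<Longrightarrow> \<not> m dvd b \<Longrightarrow> coord (A\<^sub>0 *\<^sub>v e) k b = 0"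
  shows "L2_set (\<lambda>b. cmod (coord (A\<^sub>0 *\<^sub>v (mgrit_err_prop n m N\<^sub>0 \<Phi>\<^sub>0 \<Phi>\<^sub>1 r *\<^sub>v e)) k b)) {..<N\<^sub>0}
    \<le> cmod (\<mu>\<^sub>0 k ^ m - \<mu>\<^sub>1 k) * cmod (\<mu>\<^sub>0 k) ^ (r * m) * (\<Sum>i<N\<^sub>1 - 1 - r. cmod (\<mu>\<^sub>1 k) ^ i)
      * L2_set (\<lambda>b. cmod (coord (A\<^sub>0 *\<^sub>v e) k b)) {..<N\<^sub>0}"
proof -
  let ?e' = "mgrit_err_prop n m N\<^sub>0 \<Phi>\<^sub>0 \<Phi>\<^sub>1 r *\<^sub>v e"
  let ?K = "(\<mu>\<^sub>0 k ^ m - \<mu>\<^sub>1 k) * \<mu>\<^sub>0 k ^ (r * m)"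
  have "L2_set (\<lambda>j. cmod (coord (A\<^sub>0 *\<^sub>v ?e') k (j * m))) {..<N\<^sub>1}
      \<le> cmod ?K * (\<Sum>i<N\<^sub>1 - 1 - r. cmod (\<mu>\<^sub>1 k) ^ i) * L2_set (\<lambda>j. cmod (coord (A\<^sub>0 *\<^sub>v e) k (j * m))) {..<N\<^sub>1}"
    by (rule L2_set_recurrence) (rule residual_step(3)[OF e _ k F])
  moreover have "L2_set (\<lambda>b. cmod (coord (A\<^sub>0 *\<^sub>v ?e') k b)) {..<N\<^sub>0}
      = L2_set (\<lambda>j. cmod (coord (A\<^sub>0 *\<^sub>v ?e') k (j * m))) {..<N\<^sub>1}"
    by (rule L2_set_C_points) (simp add: residual_step(2)[OF e _ k])
  moreover have "L2_set (\<lambda>b. cmod (coord (A\<^sub>0 *\<^sub>v e) k b)) {..<N\<^sub>0}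
      = L2_set (\<lambda>j. cmod (coord (A\<^sub>0 *\<^sub>v e) k (j * m))) {..<N\<^sub>1}"
    by (rule L2_set_C_points) (simp add: F)
  ultimately show ?thesis by (simp add: norm_mult norm_power)
qed

end

section \<open>Eigenvalue bound from stability, and assembly of the modes\<close>

text \<open>The eigenvector \<open>U *\<^sub>v unit_vec n k\<close> has a unit vector as
  coefficients, so its quotient in the operator norm is exactly
  \<open>cmod (\<mu> k)\<close>.\<close>

lemma cmod_eigenvalue_less_1:
  assumes U: "U \<in> carrier_mat n n" and W: "W \<in> carrier_mat n n" and WU: "W * U = 1\<^sub>m n"
    and \<Phi>: "diagonalized_by n W \<Phi> \<mu>" and stable: "eig_op_norm n U \<Phi> < 1" and k: "k < n"
  shows "cmod (\<mu> k) < 1"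
proof -
  define x where "x = U *\<^sub>v unit_vec n k"
  have x: "x \<in> carrier_vec n" using U by (simp add: x_def)
  have B: "\<Phi> \<in> carrier_mat n n" "W * \<Phi> = mat_diag n \<mu> * W" using \<Phi> by (simp_all add: diagonalized_by_def)
  have Wx: "W *\<^sub>v x = unit_vec n k"
    unfolding x_def using assoc_mult_mat_vec[OF W U unit_vec_carrier] WU by simp
  have "x \<noteq> 0\<^sub>v n"
  proof
    assume "x = 0\<^sub>v n"
    then have "(W *\<^sub>v x) $ k = 0" using W k by simp
    then show False using Wx k by simp
  qed
  have "W *\<^sub>v (\<Phi> *\<^sub>v x) = mat_diag n \<mu> *\<^sub>v unit_vec n k"
    using assoc_mult_mat_vec[OF W B(1) x] assoc_mult_mat_vec[OF mat_diag_dim W x] B(2) Wx by metis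
  then have W\<Phi>x: "(W *\<^sub>v (\<Phi> *\<^sub>v x)) $ i = (if i = k then \<mu> k else 0)" if "i < n" for i
    using that k by (simp add: mat_diag_def)
  have "eig_norm U x = sqrt (\<Sum>i<n. if i = k then 1 else 0)"
    unfolding eig_norm_eq[OF U W WU x] Wx using k
    by (intro arg_cong[where f = sqrt] sum.cong) auto
  moreover have "eig_norm U (\<Phi> *\<^sub>v x) = sqrt (\<Sum>i<n. if i = k then (cmod (\<mu> k))\<^sup>2 else 0)"
    unfolding eig_norm_eq[OF U W WU mult_mat_vec_carrier[OF B(1) x]]
    by (intro arg_cong[where f = sqrt] sum.cong) (auto simp: W\<Phi>x simp del: index_mult_mat_vec)
  ultimately have "ereal (cmod (\<mu> k)) = ereal (eig_norm U (\<Phi> *\<^sub>v x) / eig_norm U x)"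
    using k by simp
  also have "\<dots> \<le> eig_op_norm n U \<Phi>"
    unfolding eig_op_norm_def using x \<open>x \<noteq> 0\<^sub>v n\<close> by (intro SUP_upper) auto
  finally have "ereal (cmod (\<mu> k)) < ereal 1"
    using stable unfolding one_ereal_def by (rule le_less_trans)
  then show ?thesis by simp
qed

lemma diagonalized_by_similar:
  assumes U: "U \<in> carrier_mat n n" and W: "W \<in> carrier_mat n n" and WU: "W * U = 1\<^sub>m n"
  shows "diagonalized_by n W (U * mat_diag n d * W) d"
proof -
  have UD: "U * mat_diag n d \<in> carrier_mat n n" by (rule mult_carrier_mat[OF U mat_diag_dim])
  have "W * (U * mat_diag n d * W) = W * (U * mat_diag n d) * W"
    using assoc_mult_mat[OF W UD W] by simp
  also have "W * (U * mat_diag n d) = mat_diag n d"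
    using assoc_mult_mat[OF W U mat_diag_dim, of d] WU left_mult_one_mat[OF mat_diag_dim, of n d] by simp
  finally show ?thesis using mult_carrier_mat[OF UD W] by (simp add: diagonalized_by_def)
qed

text \<open>The estimate needs a residual that vanishes at F-points. An arbitrary initial guess
  attains this only after one iteration, hence the supremum from step 1 on; an F-relaxed start
  allows all steps.\<close>

theorem theorem4p3:
  fixes N\<^sub>x m\<^sub>0 N\<^sub>0 N\<^sub>1 r :: nat
    and \<Phi>\<^sub>0 \<Phi>\<^sub>1 U :: "complex mat"
    and \<mu>\<^sub>0 \<mu>\<^sub>1 :: "nat \<Rightarrow> complex"
    and e res :: "nat \<Rightarrow> complex vec"
    and bound :: real
  assumes "N\<^sub>x \<ge> 1" and "m\<^sub>0 \<ge> 1" and "N\<^sub>0 \<ge> 1" and "m\<^sub>0 dvd N\<^sub>0 - 1"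
    and "N\<^sub>1 = coarse_points m\<^sub>0 N\<^sub>0"
    and "U \<in> carrier_mat N\<^sub>x N\<^sub>x" and "invertible_mat U"
    and "\<Phi>\<^sub>0 = U * mat_diag N\<^sub>x \<mu>\<^sub>0 * minv U"
    and "\<Phi>\<^sub>1 = U * mat_diag N\<^sub>x \<mu>\<^sub>1 * minv U"
    and "eig_op_norm N\<^sub>x U \<Phi>\<^sub>0 < 1" and "eig_op_norm N\<^sub>x U \<Phi>\<^sub>1 < 1"
    and "e 0 \<in> carrier_vec (N\<^sub>0 * N\<^sub>x)"
    and "\<And>i. e (Suc i) = mgrit_err_prop N\<^sub>x m\<^sub>0 N\<^sub>0 \<Phi>\<^sub>0 \<Phi>\<^sub>1 r *\<^sub>v e i"
    and "\<And>i. res i = time_op N\<^sub>x N\<^sub>0 \<Phi>\<^sub>0 *\<^sub>v e i"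
    and "bound = Max ((\<lambda>k. cmod (\<mu>\<^sub>0 k ^ m\<^sub>0 - \<mu>\<^sub>1 k) * cmod (\<mu>\<^sub>0 k) ^ (r * m\<^sub>0)
             * ((1 - cmod (\<mu>\<^sub>1 k) ^ (N\<^sub>1 - 1 - r)) / (1 - cmod (\<mu>\<^sub>1 k)))) ` {..<N\<^sub>x})"
  shows "worst_case_factor (block_diag N\<^sub>x N\<^sub>0 U) res {1..} \<le> ereal bound \<and>
    (vanishes_at_F_points N\<^sub>x m\<^sub>0 N\<^sub>0 (res 0) \<longrightarrow>
      worst_case_factor (block_diag N\<^sub>x N\<^sub>0 U) res UNIV \<le> ereal bound)"
proof -
  define W where "W = minv U"
  define L where "L = (N\<^sub>0 - 1) div m\<^sub>0"
  let ?V = "block_diag N\<^sub>x N\<^sub>0 U"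
  obtain X where X: "U * X = 1\<^sub>m N\<^sub>x" "X * U = 1\<^sub>m (dim_row X)"
    using assms(6,7) by (auto simp: invertible_mat_def inverts_mat_def)
  \<comment> \<open>\<open>invertible_mat\<close> leaves the shape of the inverse open; comparing
    dimensions of the two products recovers it.\<close>
  have "dim_row X = N\<^sub>x" "dim_col X = N\<^sub>x"
    using arg_cong[OF X(1), of dim_col] arg_cong[OF X(2), of dim_col] assms(6) by simp_all
  then have "X \<in> carrier_mat N\<^sub>x N\<^sub>x" "X * U = 1\<^sub>m N\<^sub>x" using X by auto
  note Winv = minv_inverse[OF assms(6) this, folded W_def]
  note \<Phi> = diagonalized_by_similar[OF assms(6) Winv(1,3)]
  have \<Phi>\<^sub>0: "diagonalized_by N\<^sub>x W \<Phi>\<^sub>0 \<mu>\<^sub>0" and \<Phi>\<^sub>1: "diagonalized_by N\<^sub>x W \<Phi>\<^sub>1 \<mu>\<^sub>1"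
    using \<Phi>[of \<mu>\<^sub>0] \<Phi>[of \<mu>\<^sub>1] assms(8,9) by (simp_all add: W_def)
  interpret mgrit N\<^sub>x m\<^sub>0 L N\<^sub>0 N\<^sub>1 W \<Phi>\<^sub>0 \<Phi>\<^sub>1 \<mu>\<^sub>0 \<mu>\<^sub>1
    using assms(2-5) Winv \<Phi>\<^sub>0 \<Phi>\<^sub>1 by unfold_locales (auto simp: L_def coarse_points_def)
  have e: "e i \<in> carrier_vec (N\<^sub>0 * N\<^sub>x)" for i
    by (induction i) (simp_all add: assms(12,13) residual_step(1))
  have res: "res i \<in> carrier_vec (N\<^sub>0 * N\<^sub>x)" for i
    unfolding assms(14) using mult_mat_vec_carrier[OF carriers(1) e] .
  note norm_eq = eig_norm_block_diag[OF assms(6) Winv(1,3) res]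
  \<comment> \<open>The geometric sum is manifestly nonnegative;
    \<open>cmod (\<mu>\<^sub>1 k) < 1\<close> turns it into the quotient.\<close>
  define q where "q = (\<lambda>k. cmod (\<mu>\<^sub>0 k ^ m\<^sub>0 - \<mu>\<^sub>1 k) * cmod (\<mu>\<^sub>0 k) ^ (r * m\<^sub>0)
      * (\<Sum>i<N\<^sub>1 - 1 - r. cmod (\<mu>\<^sub>1 k) ^ i))"
  have q_nonneg: "0 \<le> q k" for k by (simp add: q_def sum_nonneg)
  have q_bound: "q k \<le> bound" if k: "k < N\<^sub>x" for k
  proof -
    have "cmod (\<mu>\<^sub>1 k) < 1"
      using cmod_eigenvalue_less_1[OF assms(6) Winv(1,3) \<Phi>\<^sub>1 assms(11) k] .
    then have "q k = cmod (\<mu>\<^sub>0 k ^ m\<^sub>0 - \<mu>\<^sub>1 k) * cmod (\<mu>\<^sub>0 k) ^ (r * m\<^sub>0)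
        * ((1 - cmod (\<mu>\<^sub>1 k) ^ (N\<^sub>1 - 1 - r)) / (1 - cmod (\<mu>\<^sub>1 k)))"
      unfolding q_def by (simp add: sum_gp_strict)
    then show ?thesis unfolding assms(15) using k by (intro Max_ge) auto
  qed
  \<comment> \<open>\<open>N\<^sub>x \<ge> 1\<close> provides mode 0, whose nonnegative factor lies
    below the maximum.\<close>
  have bound_nonneg: "0 \<le> bound" using q_bound[of 0] q_nonneg[of 0] assms(1) by simp
  have eig_norm_nonneg: "0 \<le> eig_norm ?V (res i)" for i
    using eig_norm_eq[OF _ _ block_diag_mult[OF assms(6) Winv(1,3)] res]
    by (simp add: block_diag_def block_mat_carrier sum_nonneg)
  have ratio: "ereal (eig_norm ?V (res (Suc i)) / eig_norm ?V (res i)) \<le> ereal bound"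
    if F: "\<And>b k. b < N\<^sub>0 \<Longrightarrow> k < N\<^sub>x \<Longrightarrow> \<not> m\<^sub>0 dvd b \<Longrightarrow> coord (res i) k b = 0" for i
  proof -
    let ?S = "\<lambda>i k. L2_set (\<lambda>b. cmod (coord (res i) k b)) {..<N\<^sub>0}"
    have S: "?S (Suc i) k \<le> bound * ?S i k" if k: "k < N\<^sub>x" for k
    proof -
      have "?S (Suc i) k \<le> q k * ?S i k"
        unfolding q_def using L2_set_step[OF e k F[OF _ k, unfolded assms(14)]] by (simp add: assms(13,14))
      also have "\<dots> \<le> bound * ?S i k" using q_bound[OF k] by (intro mult_right_mono) auto
      finally show ?thesis .
    qed
    have "(eig_norm ?V (res (Suc i)))\<^sup>2 \<le> (\<Sum>k<N\<^sub>x. (bound * ?S i k)\<^sup>2)"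
      unfolding norm_eq using S by (intro sum_mono power_mono) auto
    also have "\<dots> = (bound * eig_norm ?V (res i))\<^sup>2"
      by (simp add: power_mult_distrib norm_eq sum_distrib_left)
    finally have "eig_norm ?V (res (Suc i)) \<le> bound * eig_norm ?V (res i)"
      by (rule power2_le_imp_le) (simp add: bound_nonneg eig_norm_nonneg)
    \<comment> \<open>For a zero residual the quotient is 0 by the convention for division, which
      nonnegativity of \<open>bound\<close> covers.\<close>
    then show ?thesis
      using bound_nonneg eig_norm_nonneg[of i] by (cases "eig_norm ?V (res i) = 0") (auto simp: divide_le_eq)
  qed
  have F_Suc: "coord (res (Suc i)) k b = 0" if "b < N\<^sub>0" "k < N\<^sub>x" "\<not> m\<^sub>0 dvd b" for i b k
    using residual_step(2)[OF e that] by (simp add: assms(13,14))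
  \<comment> \<open>The coordinates at a block combine entries of that block only, so they vanish
    with it.\<close>
  have F_0: "coord (res 0) k b = 0"
    if "vanishes_at_F_points N\<^sub>x m\<^sub>0 N\<^sub>0 (res 0)" "b < N\<^sub>0" "\<not> m\<^sub>0 dvd b" for b k
    using that by (simp add: vanishes_at_F_points_def block_coord_def)
  have "worst_case_factor ?V res {1..} \<le> ereal bound"
    unfolding worst_case_factor_def
  proof (rule SUP_least)
    fix i :: nat assume i: "i \<in> {1..}"
    show "ereal (eig_norm ?V (res (Suc i)) / eig_norm ?V (res i)) \<le> ereal bound"
    proof (rule ratio)
      fix b k assume "b < N\<^sub>0" "k < N\<^sub>x" "\<not> m\<^sub>0 dvd b"
      then show "coord (res i) k b = 0" using F_Suc[of b k "i - 1"] i by simp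
    qed
  qed
  moreover have "worst_case_factor ?V res UNIV \<le> ereal bound" if "vanishes_at_F_points N\<^sub>x m\<^sub>0 N\<^sub>0 (res 0)"
    unfolding worst_case_factor_def
  proof (rule SUP_least)
    fix i :: nat
    show "ereal (eig_norm ?V (res (Suc i)) / eig_norm ?V (res i)) \<le> ereal bound"
    proof (rule ratio)
      fix b k assume "b < N\<^sub>0" "k < N\<^sub>x" "\<not> m\<^sub>0 dvd b"
      then show "coord (res i) k b = 0" using F_Suc F_0[OF that] by (cases i) simp_all
    qed
  qed
  ultimately show ?thesis by blast
qed

end
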